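(* Let $I\in\mathbb{N}$ and let $r,r_1,r_2\in\mathbb{N}$ be such that $r=r_1r_2$. Let the functions $b,b_{1i},b_{2i}:\mathbb{Z}\to\mathbb{C}$ ($1\le i\le I$) and $R_1,R_2\in\mathbb{R}$ be such that $$b(m)=\sum_{i=1}^{I}b_{1i}(m)b_{2i}(m)\qquad(m\in\mathbb{Z})$$ and, for all $m\in\mathbb{Z}$ and $1\le i\le I$, $$b_{1i}(m+r_1)=b_{1i}(m),\quad|b_{1i}(m)|\le R_1,\qquad b_{2i}(m+r_2)=b_{2i}(m),\quad|b_{2i}(m)|\le R_2.$$ Let $H\in\mathbb{N}$, and for $h,k\in\mathbb{Z}$ and $1\le i\le I$ let $$\hat B_{1i,hH}(k)=\sum_{m\bmod r_1}b_{1i}(m+hHr_2)\overline{b_{1i}(m)}\,e\Bigl(-\frac{km}{r_1}\Bigr).$$ Then, for every $A\in\mathbb{Z}$ and $M\in\mathbb{N}$, $$\Bigl|\sum_{A<m\le A+M}b(m)\Bigr|^2\ll(M+Hr_2)Hr_2(R_1R_2)^2I^2+Hr_2R_2^2I\sum_{0<|h|\le\frac{M}{Hr_2}}\ \sum_{|k|\le r_1/2}\Bigl|\sum_{i=1}^{I}\hat B_{1i,hH}(k)\Bigr|\min\Bigl(\frac{M}{r_1},\frac1{|k|}\Bigr),$$ with an absolute implied constant.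
   Context: $e(x)=e^{2\pi ix}$. For $k=0$, $\min(M/r_1,1/|k|)$ is read as $M/r_1$. The sums over $h,k$ are over integers. *)

theory Defs
  imports Complex_Main
begin

definition e_fn :: "real \<Rightarrow> complex" where
  "e_fn x = exp (2 * complex_of_real pi * \<i> * complex_of_real x)"

(* The sum runs over the representatives 0, ..., r1 - 1 of the residues modulo r1;
   for r1-periodic b1 the summand depends only on m modulo r1. *)
definition B_hat :: "nat \<Rightarrow> nat \<Rightarrow> nat \<Rightarrow> (int \<Rightarrow> complex) \<Rightarrow> int \<Rightarrow> int \<Rightarrow> complex" where
  "B_hat r1 r2 H b1 h k =
     (\<Sum>m\<in>{0..<int r1}. b1 (m + h * int H * int r2) * cnj (b1 m)
        * e_fn (- (real_of_int k * real_of_int m / real r1)))"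

(* min (M / r1, 1 / |k|), where k = 0 means that the second bound is absent. *)
definition min_weight :: "nat \<Rightarrow> nat \<Rightarrow> int \<Rightarrow> real" where
  "min_weight M r1 k =
     (if k = 0 then real M / real r1 else min (real M / real r1) (1 / real_of_int \<bar>k\<bar>))"

end

theory Submission
  imports Defs "HOL-Analysis.Complex_Transcendental"
begin

text \<open>Put \<open>L = H r\<^sub>2\<close>. If \<open>M < L\<close>, the trivial bound suffices. Otherwise apply van der Corput's
  shifting argument with the shifts \<open>k L\<close>, \<open>0 \<le> k < K = \<lfloor>M / L\<rfloor>\<close>. These are multiples of
  \<open>r\<^sub>2\<close>, so after Cauchy's inequality over the pairs \<open>(i, m)\<close> the factors \<open>b\<^sub>2\<^sub>i\<close> are bounded by
  \<open>R\<^sub>2\<close>, and what remains are correlations \<open>\<Sum>\<^sub>n \<Sum>\<^sub>i b\<^sub>1\<^sub>i(n + h L) cnj (b\<^sub>1\<^sub>i(n))\<close> over intervals.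
  The term \<open>h = 0\<close> is bounded trivially; the others have \<open>r\<^sub>1\<close>-periodic summands and are
  completed by finite Fourier inversion and the geometric series.\<close>

section \<open>The additive character \<open>e_fn\<close>\<close>

lemma e_fn_eq_cis: "e_fn x = cis (2 * pi * x)"
  by (simp add: e_fn_def cis_conv_exp mult_ac)

lemma e_fn_add: "e_fn (x + y) = e_fn x * e_fn y"
  by (simp add: e_fn_eq_cis cis_mult distrib_left)

lemma norm_e_fn [simp]: "norm (e_fn x) = 1"
  by (simp add: e_fn_eq_cis)

lemma e_fn_nonzero [simp]: "e_fn x \<noteq> 0"
  by (simp add: e_fn_eq_cis)

lemma e_fn_of_int_mult: "e_fn (of_int n * x) = e_fn x powi n"
  by (simp add: e_fn_eq_cis cis_power_int mult_ac)

lemma e_fn_of_int [simp]: "e_fn (of_int n) = 1"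
  by (simp add: e_fn_eq_cis cis_multiple_2pi)

lemma e_fn_eq_1D:
  assumes "e_fn x = 1"
  shows "x \<in> \<int>"
proof -
  have "exp (2 * complex_of_real pi * \<i> * complex_of_real x) = 1"
    using assms by (simp add: e_fn_def)
  then obtain n :: int where "2 * pi * x = of_int (2 * n) * pi"
    by (auto simp: exp_eq_1)
  then have "x = of_int n" by simp
  then show ?thesis by simp
qed

text \<open>With \<open>t = pi * x\<close>, the left-out distance is a chord:
  \<open>norm (e_fn x - 1) = 2 * \<bar>sin t\<bar>\<close>. The cubic Taylor remainder and
  \<open>\<bar>t\<bar> \<le> 2\<close> give
  \<open>\<bar>sin t\<bar> \<ge> \<bar>t\<bar> / 3\<close>, and \<open>pi > 3\<close> does the rest.
  The constant 2 is not sharp, but it exactly cancels the 2 bounding the numerator of a geometric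
  sum.\<close>

lemma norm_e_fn_minus_1_ge:
  assumes "\<bar>x\<bar> \<le> 1 / 2"
  shows "2 * \<bar>x\<bar> \<le> norm (e_fn x - 1)"
proof -
  define t where "t = pi * x"
  have at: "\<bar>t\<bar> = pi * \<bar>x\<bar>" by (simp add: t_def abs_mult)
  have "\<bar>sin t - (\<Sum>m<3. sin_coeff m * t ^ m)\<bar> \<le> inverse (fact 3) * \<bar>t\<bar> ^ 3"
    by (rule Maclaurin_sin_bound)
  then have mac: "\<bar>sin t - t\<bar> \<le> \<bar>t\<bar> ^ 3 / 6"
    by (simp add: sin_coeff_def numeral_3_eq_3 fact_numeral divide_simps)
  have "\<bar>t\<bar> \<le> pi * (1/2)" unfolding at using assms by (intro mult_left_mono) auto
  then have "\<bar>t\<bar> \<le> 2" using pi_less_4 by linarith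
  then have "\<bar>t\<bar> ^ 2 \<le> 2 ^ 2" by (intro power_mono) auto
  then have "\<bar>t\<bar> * \<bar>t\<bar> ^ 2 \<le> \<bar>t\<bar> * 4" by (intro mult_left_mono) auto
  then have "\<bar>t\<bar> ^ 3 \<le> 4 * \<bar>t\<bar>" by (simp add: power3_eq_cube power2_eq_square)
  then have "\<bar>t\<bar> / 3 \<le> \<bar>sin t\<bar>" using mac by linarith
  moreover have "3 * \<bar>x\<bar> \<le> \<bar>t\<bar>" unfolding at using pi_gt3 by (intro mult_right_mono) auto
  ultimately have "\<bar>x\<bar> \<le> \<bar>sin t\<bar>" by linarith
  moreover have "norm (e_fn x - 1) = 2 * \<bar>sin t\<bar>"
    using dist_exp_i_1[of "2 * pi * x"] by (simp add: e_fn_def t_def mult_ac)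
  ultimately show ?thesis by simp
qed

section \<open>Geometric sums of additive characters\<close>

lemma sum_powi_interval:
  fixes z :: complex
  assumes "z \<noteq> 0"
  shows "(\<Sum>n\<in>{a..<a + int N}. z powi n) = z powi a * (\<Sum>j<N. z ^ j)"
proof -
  have "(\<Sum>n\<in>{a..<a + int N}. z powi n) = (\<Sum>j<N. z powi (a + int j))"
    by (rule sum.reindex_bij_witness[of _ "\<lambda>j. a + int j" "\<lambda>n. nat (n - a)"]) auto
  then show ?thesis
    using assms by (simp add: power_int_add sum_distrib_left)
qed

text \<open>Orthogonality of characters: when \<open>q\<close> does not divide \<open>d\<close>,
  \<open>e_fn (d / q)\<close> is a \<open>q\<close>-th root of unity other than 1, so its powers
  over a full period cancel. The start \<open>a\<close> is left free to allow residues centred at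
  0.\<close>

lemma sum_e_fn_complete_residues:
  assumes "q \<ge> 1"
  shows "(\<Sum>k\<in>{a..<a + int q}. e_fn (of_int k * (of_int d / real q)))
           = (if int q dvd d then of_nat q else 0)"
proof (cases "int q dvd d")
  case True
  then obtain c where "d = int q * c" by auto
  then have eq: "of_int d / real q = of_int c" using assms by simp
  have "e_fn (of_int k * of_int c) = 1" for k
    using e_fn_of_int[of "k * c"] by simp
  then show ?thesis using True by (simp add: eq)
next
  case False
  define z where "z = e_fn (of_int d / real q)"
  have "z \<noteq> 1"
  proof
    assume "z = 1"
    then have "of_int d / real q \<in> \<int>" unfolding z_def by (rule e_fn_eq_1D)
    then obtain c where "of_int d / real q = of_int c" by (auto elim: Ints_cases)
    then have "real_of_int d = of_int (int q * c)" using assms by (simp add: field_simps)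
    then have "d = int q * c" by (simp only: of_int_eq_iff)
    then show False using False by simp
  qed
  moreover have "z ^ q = 1"
    using e_fn_of_int_mult[of "int q" "of_int d / real q"] e_fn_of_int[of d] assms
    by (simp add: z_def power_int_of_nat)
  then have "(z - 1) * (\<Sum>j<q. z ^ j) = 0"
    by (simp flip: power_diff_1_eq)
  ultimately have "(\<Sum>j<q. z ^ j) = 0" by simp
  then show ?thesis
    unfolding e_fn_of_int_mult z_def[symmetric]
    using False by (simp add: sum_powi_interval z_def)
qed

text \<open>Counting terms gives the bound \<open>M\<close>; for \<open>k \<noteq> 0\<close> the
  closed form of the geometric series gives \<open>2 / norm (z - 1) \<le> q / \<bar>k\<bar>\<close>,
  where \<open>\<bar>k\<bar> \<le> q / 2\<close> makes the chord bound applicable. The factor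
  \<open>q\<close> turns \<open>min_weight\<close> into the minimum of these two bounds.\<close>

lemma norm_sum_e_fn_le:
  assumes "q \<ge> 1" and "real_of_int \<bar>k\<bar> \<le> real q / 2" and "N \<le> M"
  shows "norm (\<Sum>n\<in>{a..<a + int N}. e_fn (of_int n * (of_int k / real q)))
           \<le> real q * min_weight M q k"
proof -
  define z where "z = e_fn (of_int k / real q)"
  define S where "S = (\<Sum>j<N. z ^ j)"
  have nz: "norm z = 1" "z \<noteq> 0" by (simp_all add: z_def)
  have eq: "norm (\<Sum>n\<in>{a..<a + int N}. e_fn (of_int n * (of_int k / real q))) = norm S"
    unfolding e_fn_of_int_mult z_def[symmetric]
    by (simp add: sum_powi_interval norm_mult norm_power_int nz S_def)
  have "norm S \<le> (\<Sum>j<N. norm (z ^ j))" unfolding S_def by (rule norm_sum)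
  also have "\<dots> = real N" by (simp add: norm_power nz)
  finally have triv: "norm S \<le> real M" using assms by linarith
  have "norm S \<le> real q / real_of_int \<bar>k\<bar>" if "k \<noteq> 0"
  proof -
    have "2 * \<bar>of_int k / real q\<bar> \<le> norm (z - 1)" unfolding z_def
      using assms by (intro norm_e_fn_minus_1_ge) (auto simp: field_simps)
    then have "2 * \<bar>of_int k / real q\<bar> * norm S \<le> norm (z - 1) * norm S"
      by (rule mult_right_mono) simp
    also have "\<dots> = norm (z ^ N - 1)"
      by (simp add: power_diff_1_eq norm_mult S_def)
    also have "\<dots> \<le> norm (z ^ N) + norm (1::complex)" by (rule norm_triangle_ineq4)
    also have "\<dots> = 2" by (simp add: norm_power nz)
    finally show ?thesis using that assms by (simp add: field_simps)
  qed
  then show ?thesis unfolding eq min_weight_def using triv assms by (auto simp: field_simps min_def)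
qed

section \<open>Completion of incomplete sums of periodic functions\<close>

lemma periodic_int_mult:
  fixes f :: "int \<Rightarrow> 'a" and q :: int
  assumes "\<And>m. f (m + q) = f m"
  shows "f (m + j * q) = f m"
proof (induction j rule: int_induct[where k = 0])
  case (step1 i)
  then show ?case using assms[of "m + i * q"] by (simp add: algebra_simps)
next
  case (step2 i)
  then show ?case using assms[of "m + (i - 1) * q"] by (simp add: algebra_simps)
qed simp

lemma finite_int_abs_le: "finite {k::int. real_of_int \<bar>k\<bar> \<le> x}"
proof (rule finite_subset)
  show "{k::int. real_of_int \<bar>k\<bar> \<le> x} \<subseteq> {-\<lfloor>x\<rfloor>..\<lfloor>x\<rfloor>}"
    by (auto simp: le_floor_iff abs_le_iff minus_le_iff)
qed simp

lemma min_weight_nonneg: "min_weight M q k \<ge> 0"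
  by (auto simp: min_weight_def)

text \<open>Completion: expand the periodic function in its finite Fourier series
  over the residues nearest to 0.\<close>

lemma norm_sum_periodic_le:
  fixes f :: "int \<Rightarrow> complex"
  assumes "q \<ge> 1" and per: "\<And>m. f (m + int q) = f m" and "N \<le> M"
  shows "norm (\<Sum>n\<in>{a..<a + int N}. f n) \<le>
    (\<Sum>k\<in>{k::int. real_of_int \<bar>k\<bar> \<le> real q / 2}.
      norm (\<Sum>m\<in>{0..<int q}. f m * e_fn (- (real_of_int k * real_of_int m / real q)))
        * min_weight M q k)"
proof -
  \<comment> \<open>\<open>K\<close> is a complete residue system with absolute values at most
    \<open>q / 2\<close>; for even \<open>q\<close> it contains \<open>q / 2\<close> but not
    \<open>- q / 2\<close>.\<close>
  define s where "s = - (int (q - 1) div 2)"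
  define K where "K = {s..<s + int q}"
  define c where "c k = (\<Sum>m\<in>{0..<int q}. f m * e_fn (- (real_of_int k * real_of_int m / real q)))" for k
  define J where "J = {a..<a + int N}"
  have K_sub: "K \<subseteq> {k::int. real_of_int \<bar>k\<bar> \<le> real q / 2}"
  proof
    fix k assume "k \<in> K"
    then have "2 * \<bar>k\<bar> \<le> int q" using assms unfolding K_def s_def by auto
    then have "real_of_int (2 * \<bar>k\<bar>) \<le> real_of_int (int q)" by (simp only: of_int_le_iff)
    then show "k \<in> {k::int. real_of_int \<bar>k\<bar> \<le> real q / 2}" by simp
  qed
  \<comment> \<open>Fourier inversion: after swapping the sums, orthogonality leaves only the
    residue \<open>m = n mod q\<close>, and periodicity replaces it by \<open>n\<close>.\<close>
  have inversion: "of_nat q * f n = (\<Sum>k\<in>K. c k * e_fn (of_int n * (of_int k / real q)))" for n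
  proof -
    have "(\<Sum>k\<in>K. c k * e_fn (of_int n * (of_int k / real q)))
        = (\<Sum>k\<in>K. \<Sum>m\<in>{0..<int q}. f m * e_fn (of_int k * (of_int (n - m) / real q)))"
      unfolding c_def sum_distrib_right
      by (intro sum.cong refl)
         (simp add: mult.assoc flip: e_fn_add, simp add: algebra_simps diff_divide_distrib)
    also have "\<dots> = (\<Sum>m\<in>{0..<int q}. f m * (if int q dvd n - m then of_nat q else 0))"
      unfolding K_def
      by (subst sum.swap) (simp only: sum_distrib_left[symmetric] sum_e_fn_complete_residues[OF assms(1)])
    also have "\<dots> = (\<Sum>m\<in>{0..<int q}. if m = n mod int q then f m * of_nat q else 0)"
    proof (intro sum.cong refl)
      fix m assume m: "m \<in> {0..<int q}"
      have "int q dvd n - m \<longleftrightarrow> n mod int q = m mod int q" by (simp add: mod_eq_dvd_iff)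
      also have "\<dots> \<longleftrightarrow> m = n mod int q" using m by auto
      finally show "f m * (if int q dvd n - m then of_nat q else 0)
          = (if m = n mod int q then f m * of_nat q else 0)" by simp
    qed
    also have "\<dots> = f (n mod int q) * of_nat q"
      using assms by (simp add: sum.delta')
    also have "f (n mod int q) = f n"
      using periodic_int_mult[of f "int q" "n mod int q" "n div int q", OF per] by simp
    finally show ?thesis by (simp add: mult.commute)
  qed
  have "of_nat q * (\<Sum>n\<in>J. f n) = (\<Sum>k\<in>K. c k * (\<Sum>n\<in>J. e_fn (of_int n * (of_int k / real q))))"
    unfolding sum_distrib_left inversion by (rule sum.swap)
  then have "real q * norm (\<Sum>n\<in>J. f n)
      = norm (\<Sum>k\<in>K. c k * (\<Sum>n\<in>J. e_fn (of_int n * (of_int k / real q))))"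
    by (metis norm_mult norm_of_nat)
  also have "\<dots> \<le> (\<Sum>k\<in>K. norm (c k) * (real q * min_weight M q k))"
    unfolding J_def norm_mult
  proof (intro sum_norm_le)
    fix k assume "k \<in> K"
    then have "real_of_int \<bar>k\<bar> \<le> real q / 2" using K_sub by blast
    then show "norm (c k * (\<Sum>n\<in>{a..<a + int N}. e_fn (of_int n * (of_int k / real q))))
        \<le> norm (c k) * (real q * min_weight M q k)"
      unfolding norm_mult by (intro mult_left_mono norm_sum_e_fn_le assms) auto
  qed
  \<comment> \<open>The only index that can be added is \<open>- q / 2\<close>, for even
    \<open>q\<close>; its term is nonnegative.\<close>
  also have "\<dots> \<le> (\<Sum>k\<in>{k::int. real_of_int \<bar>k\<bar> \<le> real q / 2}. norm (c k) * (real q * min_weight M q k))"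
    using K_sub by (intro sum_mono2 finite_int_abs_le) (auto simp: min_weight_nonneg)
  also have "\<dots> = real q * (\<Sum>k\<in>{k::int. real_of_int \<bar>k\<bar> \<le> real q / 2}. norm (c k) * min_weight M q k)"
    by (simp add: sum_distrib_left mult_ac)
  finally show ?thesis using assms unfolding c_def J_def by simp
qed

section \<open>Cauchy's inequality and van der Corput differencing\<close>

lemma norm_sum_mult_squared_le:
  fixes f g :: "'a \<Rightarrow> complex"
  shows "(norm (\<Sum>x\<in>X. f x * g x))\<^sup>2 \<le> (\<Sum>x\<in>X. (norm (f x))\<^sup>2) * (\<Sum>x\<in>X. (norm (g x))\<^sup>2)"
proof -
  have "(norm (\<Sum>x\<in>X. f x * g x))\<^sup>2 \<le> (\<Sum>x\<in>X. norm (f x) * norm (g x))\<^sup>2"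
    by (intro power_mono sum_norm_le) (auto simp: norm_mult)
  also have "\<dots> \<le> (\<Sum>x\<in>X. (norm (f x))\<^sup>2) * (\<Sum>x\<in>X. (norm (g x))\<^sup>2)"
    by (rule Cauchy_Schwarz_ineq_sum)
  finally show ?thesis .
qed

text \<open>Van der Corput differencing with shifts by multiples of \<open>L\<close>: they leave
  the second factors alone, so only the first factors are correlated.\<close>

lemma van_der_corput_products:
  fixes b1 b2 :: "'i \<Rightarrow> int \<Rightarrow> complex" and A :: int and K L M :: nat
  assumes S: "finite S" and per: "\<And>i m. i \<in> S \<Longrightarrow> b2 i (m + int L) = b2 i m"
    and bd: "\<And>i m. i \<in> S \<Longrightarrow> norm (b2 i m) \<le> R"
  defines "J \<equiv> {A<..A + int M}"
  shows "(real K)\<^sup>2 * (norm (\<Sum>m\<in>J. \<Sum>i\<in>S. b1 i m * b2 i m))\<^sup>2 \<le>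
    real (card S) * (real M + real K * real L) * R\<^sup>2 * (real K *
      (\<Sum>h\<in>{- int K<..<int K}.
        norm (\<Sum>n\<in>{n\<in>J. n + h * int L \<in> J}. \<Sum>i\<in>S. b1 i (n + h * int L) * cnj (b1 i n))))"
proof -
  \<comment> \<open>\<open>W\<close> contains every translate of \<open>J\<close> by
    \<open>- k * L\<close> with \<open>k < K\<close>, so one range of summation serves all
    shifts.\<close>
  define W where "W = {A - int K * int L<..A + int M}"
  define b where "b m = (\<Sum>i\<in>S. b1 i m * b2 i m)" for m
  \<comment> \<open>The cut-off to \<open>J\<close> is attached to \<open>b1\<close> alone, so that
    \<open>b2\<close> stays periodic.\<close>
  define g where "g i m = (if m \<in> J then b1 i m else 0)" for i m
  define T where "T i m = (\<Sum>k<K. g i (m + int k * int L))" for i m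
  define P where "P h = norm (\<Sum>n\<in>{n\<in>J. n + h * int L \<in> J}. \<Sum>i\<in>S. b1 i (n + h * int L) * cnj (b1 i n))" for h
  have finJ: "finite J" and finW: "finite W" by (simp_all add: J_def W_def)
  have shift: "x - int k * int L \<in> W" if "x \<in> J" "k < K" for x k
  proof -
    have "int k * int L \<le> int K * int L" using that by (intro mult_right_mono) auto
    moreover have "0 \<le> int k * int L" by simp
    ultimately show ?thesis using that(1)
      unfolding W_def J_def greaterThanAtMost_iff by linarith
  qed
  have per': "b2 i (m + j * int L) = b2 i m" if "i \<in> S" for i m j
    using per[OF that] by (rule periodic_int_mult)
  have window: "(\<Sum>m\<in>J. F m) = (\<Sum>m\<in>W. if m + int k * int L \<in> J then F (m + int k * int L) else 0)"
    if "k < K" for F :: "int \<Rightarrow> complex" and k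
  proof -
    have "(\<Sum>m\<in>J. F m) = (\<Sum>m\<in>{m\<in>W. m + int k * int L \<in> J}. F (m + int k * int L))"
      by (rule sum.reindex_bij_witness[of _ "\<lambda>m. m + int k * int L" "\<lambda>m. m - int k * int L"])
         (auto simp: shift that)
    also have "\<dots> = (\<Sum>m\<in>W. if m + int k * int L \<in> J then F (m + int k * int L) else 0)"
      by (rule sum.inter_filter[OF finW])
    finally show ?thesis .
  qed
  \<comment> \<open>Summing over all \<open>K\<close> shifts counts the sum \<open>K\<close> times.
    By periodicity \<open>b2 i m\<close> does not depend on the shift, so the sum over
    \<open>k\<close> can be moved inside, where it becomes \<open>T\<close>.\<close>
  have "of_nat K * (\<Sum>m\<in>J. b m) = (\<Sum>k<K. \<Sum>m\<in>W. \<Sum>i\<in>S. b2 i m * g i (m + int k * int L))"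
  proof -
    have "(\<Sum>m\<in>J. b m) = (\<Sum>m\<in>W. \<Sum>i\<in>S. b2 i m * g i (m + int k * int L))" if "k < K" for k
      unfolding window[OF that] b_def
      by (intro sum.cong refl) (auto simp: g_def per' mult.commute[of "b1 _ _"] intro!: sum.cong)
    then have "(\<Sum>k<K. \<Sum>m\<in>W. \<Sum>i\<in>S. b2 i m * g i (m + int k * int L)) = (\<Sum>k<K. \<Sum>m\<in>J. b m)"
      by (intro sum.cong[OF refl]) (simp only: lessThan_iff)
    then show ?thesis by simp
  qed
  also have "\<dots> = (\<Sum>m\<in>W. \<Sum>i\<in>S. \<Sum>k<K. b2 i m * g i (m + int k * int L))"
    by (subst sum.swap, intro sum.cong refl, rule sum.swap)
  also have "\<dots> = (\<Sum>(m, i)\<in>W \<times> S. b2 i m * T i m)"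
    by (simp only: T_def sum_distrib_left[symmetric] sum.cartesian_product)
  finally have avg: "of_nat K * (\<Sum>m\<in>J. b m) = (\<Sum>x\<in>W \<times> S. b2 (snd x) (fst x) * T (snd x) (fst x))"
    by (simp add: case_prod_unfold)
  have first: "(\<Sum>x\<in>W \<times> S. (norm (b2 (snd x) (fst x)))\<^sup>2) \<le> real (card S) * (real M + real K * real L) * R\<^sup>2"
  proof -
    have "(\<Sum>x\<in>W \<times> S. (norm (b2 (snd x) (fst x)))\<^sup>2) \<le> of_nat (card (W \<times> S)) * R\<^sup>2"
      by (intro sum_bounded_above power_mono) (auto simp: bd)
    also have "card W = M + K * L" by (simp add: W_def nat_add_distrib nat_mult_distrib flip: of_nat_mult of_nat_add)
    then have "real (card (W \<times> S)) = real (card S) * (real M + real K * real L)"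
      by (simp add: card_cartesian_product)
    finally show ?thesis .
  qed
  \<comment> \<open>The substitution \<open>n = m + l * L\<close> shows that only the difference of
    the two shifts matters.\<close>
  have corr: "norm (\<Sum>m\<in>W. \<Sum>i\<in>S. g i (m + int k * int L) * cnj (g i (m + int l * int L))) \<le> P (int k - int l)"
    if "k < K" "l < K" for k l
  proof -
    define h where "h = int k - int l"
    have "(\<Sum>m\<in>W. \<Sum>i\<in>S. g i (m + int k * int L) * cnj (g i (m + int l * int L)))
      = (\<Sum>m\<in>W. if m + int l * int L \<in> J
           then (\<Sum>i\<in>S. g i (m + int l * int L + h * int L) * cnj (b1 i (m + int l * int L))) else 0)"
      by (intro sum.cong refl) (auto simp: g_def h_def algebra_simps)
    also have "\<dots> = (\<Sum>n\<in>J. \<Sum>i\<in>S. g i (n + h * int L) * cnj (b1 i n))"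
      using window[OF that(2), of "\<lambda>n. \<Sum>i\<in>S. g i (n + h * int L) * cnj (b1 i n)"] by simp
    also have "\<dots> = (\<Sum>n\<in>J. if n + h * int L \<in> J then (\<Sum>i\<in>S. b1 i (n + h * int L) * cnj (b1 i n)) else 0)"
      by (intro sum.cong refl) (auto simp: g_def)
    also have "\<dots> = (\<Sum>n\<in>{n\<in>J. n + h * int L \<in> J}. \<Sum>i\<in>S. b1 i (n + h * int L) * cnj (b1 i n))"
      by (rule sum.inter_filter[OF finJ, symmetric])
    finally show ?thesis by (simp add: P_def h_def)
  qed
  \<comment> \<open>Written as \<open>T * cnj T\<close>, the square expands into a double sum over
    shifts \<open>k\<close>, \<open>l\<close>; moving these outermost leaves exactly the
    correlations bounded by \<open>corr\<close>.\<close>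
  have "(\<Sum>x\<in>W \<times> S. (norm (T (snd x) (fst x)))\<^sup>2) \<le> real K * (\<Sum>h\<in>{- int K<..<int K}. P h)"
  proof -
    have "complex_of_real (\<Sum>x\<in>W \<times> S. (norm (T (snd x) (fst x)))\<^sup>2)
        = (\<Sum>m\<in>W. \<Sum>i\<in>S. T i m * cnj (T i m))"
      by (simp add: sum.cartesian_product case_prod_unfold flip: complex_norm_square)
    also have "\<dots> = (\<Sum>m\<in>W. \<Sum>i\<in>S. \<Sum>k<K. \<Sum>l<K. g i (m + int k * int L) * cnj (g i (m + int l * int L)))"
      by (simp add: T_def sum_product)
    also have "\<dots> = (\<Sum>m\<in>W. \<Sum>k<K. \<Sum>i\<in>S. \<Sum>l<K. g i (m + int k * int L) * cnj (g i (m + int l * int L)))"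
      by (intro sum.cong refl sum.swap)
    also have "\<dots> = (\<Sum>m\<in>W. \<Sum>k<K. \<Sum>l<K. \<Sum>i\<in>S. g i (m + int k * int L) * cnj (g i (m + int l * int L)))"
      by (intro sum.cong refl sum.swap)
    also have "\<dots> = (\<Sum>k<K. \<Sum>m\<in>W. \<Sum>l<K. \<Sum>i\<in>S. g i (m + int k * int L) * cnj (g i (m + int l * int L)))"
      by (rule sum.swap)
    also have "\<dots> = (\<Sum>k<K. \<Sum>l<K. \<Sum>m\<in>W. \<Sum>i\<in>S. g i (m + int k * int L) * cnj (g i (m + int l * int L)))"
      by (intro sum.cong refl sum.swap)
    finally have expand: "complex_of_real (\<Sum>x\<in>W \<times> S. (norm (T (snd x) (fst x)))\<^sup>2)
        = (\<Sum>k<K. \<Sum>l<K. \<Sum>m\<in>W. \<Sum>i\<in>S. g i (m + int k * int L) * cnj (g i (m + int l * int L)))" .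
    have "norm (complex_of_real (\<Sum>x\<in>W \<times> S. (norm (T (snd x) (fst x)))\<^sup>2))
        \<le> (\<Sum>k<K. \<Sum>l<K. P (int k - int l))"
      unfolding expand by (intro sum_norm_le) (simp add: corr)
    then have "(\<Sum>x\<in>W \<times> S. (norm (T (snd x) (fst x)))\<^sup>2) \<le> (\<Sum>k<K. \<Sum>l<K. P (int k - int l))"
      unfolding norm_of_real by linarith
    \<comment> \<open>For fixed \<open>k\<close> the differences \<open>k - l\<close> are distinct
      and lie strictly between \<open>- K\<close> and \<open>K\<close>; the sum over
      \<open>k\<close> then costs a factor \<open>K\<close>.\<close>
    also have "\<dots> \<le> (\<Sum>k<K. \<Sum>h\<in>{- int K<..<int K}. P h)"
    proof (rule sum_mono)
      fix k assume "k \<in> {..<K}"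
      then have "(\<lambda>l. int k - int l) ` {..<K} \<subseteq> {- int K<..<int K}" by auto
      moreover have "(\<Sum>l<K. P (int k - int l)) = sum P ((\<lambda>l. int k - int l) ` {..<K})"
        by (subst sum.reindex) (auto simp: inj_on_def)
      ultimately show "(\<Sum>l<K. P (int k - int l)) \<le> (\<Sum>h\<in>{- int K<..<int K}. P h)"
        by (auto simp: P_def intro!: sum_mono2)
    qed
    finally show ?thesis by simp
  qed
  with first have "(\<Sum>x\<in>W \<times> S. (norm (b2 (snd x) (fst x)))\<^sup>2) * (\<Sum>x\<in>W \<times> S. (norm (T (snd x) (fst x)))\<^sup>2)
      \<le> real (card S) * (real M + real K * real L) * R\<^sup>2 * (real K * (\<Sum>h\<in>{- int K<..<int K}. P h))"
    by (intro mult_mono) (auto intro: sum_nonneg)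
  with norm_sum_mult_squared_le[of "\<lambda>x. b2 (snd x) (fst x)" "\<lambda>x. T (snd x) (fst x)" "W \<times> S"]
  have "(norm (of_nat K * (\<Sum>m\<in>J. b m)))\<^sup>2
      \<le> real (card S) * (real M + real K * real L) * R\<^sup>2 * (real K * (\<Sum>h\<in>{- int K<..<int K}. P h))"
    unfolding avg by linarith
  then show ?thesis by (simp add: norm_mult power_mult_distrib b_def P_def)
qed

section \<open>Fourier bound for the correlations\<close>

text \<open>The condition on \<open>n\<close> cuts out an interval of at most \<open>M\<close>
  integers, and the summand is \<open>r1\<close>-periodic in \<open>n\<close> with Fourier
  coefficients \<open>\<Sum>i\<in>S. B_hat r1 r2 H (b1 i) h k\<close>. Hence completion applies,
  uniformly in the shift.\<close>

lemma norm_correlation_le: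
  fixes b1 :: "nat \<Rightarrow> int \<Rightarrow> complex" and A :: int and M :: nat
  assumes "r1 \<ge> 1" and per: "\<And>i m. i \<in> S \<Longrightarrow> b1 i (m + int r1) = b1 i m"
  defines "J \<equiv> {A<..A + int M}"
  shows "norm (\<Sum>n\<in>{n\<in>J. n + h * int (H * r2) \<in> J}. \<Sum>i\<in>S. b1 i (n + h * int (H * r2)) * cnj (b1 i n))
    \<le> (\<Sum>k\<in>{k::int. real_of_int \<bar>k\<bar> \<le> real r1 / 2}.
          norm (\<Sum>i\<in>S. B_hat r1 r2 H (b1 i) h k) * min_weight M r1 k)"
proof -
  define u where "u = h * int (H * r2)"
  define f where "f n = (\<Sum>i\<in>S. b1 i (n + u) * cnj (b1 i n))" for n
  \<comment> \<open>The overlap of \<open>J\<close> with its translate by \<open>- u\<close> starts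
    at \<open>a\<close> and has \<open>M - \<bar>u\<bar>\<close> elements; if that number is
    negative, \<open>nat\<close> truncates it to 0, matching the empty overlap.\<close>
  define a where "a = max (A + 1) (A + 1 - u)"
  define N where "N = nat (min (A + int M + 1) (A + int M + 1 - u) - a)"
  have J: "{n\<in>J. n + u \<in> J} = {a..<a + int N}"
    by (auto simp: J_def a_def N_def)
  have NM: "N \<le> M" by (auto simp: a_def N_def)
  have per_f: "f (m + int r1) = f m" for m
    unfolding f_def
    using per by (intro sum.cong refl) (metis add.assoc add.commute)
  have fourier: "(\<Sum>m\<in>{0..<int r1}. f m * e_fn (- (real_of_int k * real_of_int m / real r1)))
      = (\<Sum>i\<in>S. B_hat r1 r2 H (b1 i) h k)" for k
    by (simp add: f_def B_hat_def u_def sum_distrib_right sum.swap[of _ S] mult.assoc)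
  show ?thesis
    using norm_sum_periodic_le[of r1 f N M a, OF assms(1) per_f NM]
    unfolding fourier u_def[symmetric] J by (simp only: f_def)
qed

section \<open>Trivial bounds and assembly of the estimate\<close>

text \<open>Serves twice: for the whole sum when there is no room for a shift, and, with the second
  factor the conjugate of the first, for the correlation at \<open>h = 0\<close>.\<close>

lemma norm_sum_products_le:
  fixes b1 b2 :: "'i \<Rightarrow> int \<Rightarrow> complex"
  assumes "\<And>i m. i \<in> S \<Longrightarrow> norm (b1 i m) \<le> R1" and "\<And>i m. i \<in> S \<Longrightarrow> norm (b2 i m) \<le> R2"
  shows "norm (\<Sum>m\<in>X. \<Sum>i\<in>S. b1 i m * b2 i m) \<le> real (card X) * (real (card S) * (R1 * R2))"
proof -
  have "norm (b1 i m * b2 i m) \<le> R1 * R2" if "i \<in> S" for i m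
    \<comment> \<open>The last fact supplies \<open>0 \<le> R1\<close>, which monotonicity of the
      product requires.\<close>
    using assms(1)[OF that, of m] assms(2)[OF that, of m] order_trans[OF norm_ge_zero assms(1)[OF that, of m]]
    unfolding norm_mult by (intro mult_mono) auto
  then have "norm (\<Sum>i\<in>S. b1 i m * b2 i m) \<le> real (card S) * (R1 * R2)" for m
    by (rule sum_norm_bound)
  then show ?thesis by (rule sum_norm_bound)
qed

theorem theorem10:
  "\<exists>C::real. C > 0 \<and>
    (\<forall>(I::nat) (r::nat) (r1::nat) (r2::nat) (b :: int \<Rightarrow> complex)
      (b1 :: nat \<Rightarrow> int \<Rightarrow> complex) (b2 :: nat \<Rightarrow> int \<Rightarrow> complex)
      (R1::real) (R2::real) (H::nat) (A::int) (M::nat).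
      I \<ge> 1 \<longrightarrow> r \<ge> 1 \<longrightarrow> r1 \<ge> 1 \<longrightarrow> r2 \<ge> 1 \<longrightarrow> r = r1 * r2 \<longrightarrow>
      (\<forall>m. b m = (\<Sum>i=1..I. b1 i m * b2 i m)) \<longrightarrow>
      (\<forall>m. \<forall>i\<in>{1..I}.
         b1 i (m + int r1) = b1 i m \<and> norm (b1 i m) \<le> R1 \<and>
         b2 i (m + int r2) = b2 i m \<and> norm (b2 i m) \<le> R2) \<longrightarrow>
      H \<ge> 1 \<longrightarrow> M \<ge> 1 \<longrightarrow>
      (norm (\<Sum>m\<in>{A<..A + int M}. b m))\<^sup>2
        \<le> C * ((real M + real H * real r2) * real H * real r2 * (R1 * R2)\<^sup>2 * (real I)\<^sup>2
              + real H * real r2 * R2\<^sup>2 * real I *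
                (\<Sum>h\<in>{h::int. 0 < \<bar>h\<bar> \<and> real_of_int \<bar>h\<bar> \<le> real M / (real H * real r2)}.
                  \<Sum>k\<in>{k::int. real_of_int \<bar>k\<bar> \<le> real r1 / 2}.
                    norm (\<Sum>i=1..I. B_hat r1 r2 H (b1 i) h k) * min_weight M r1 k)))"
proof (intro exI[of _ 4] conjI allI impI)
  fix I r r1 r2 H M :: nat and b :: "int \<Rightarrow> complex" and b1 b2 :: "nat \<Rightarrow> int \<Rightarrow> complex"
    and R1 R2 :: real and A :: int
  assume r1: "r1 \<ge> 1" and r2: "r2 \<ge> 1" and H: "H \<ge> 1"
    and b: "\<forall>m. b m = (\<Sum>i=1..I. b1 i m * b2 i m)"
    and bs: "\<forall>m. \<forall>i\<in>{1..I}.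
         b1 i (m + int r1) = b1 i m \<and> norm (b1 i m) \<le> R1 \<and>
         b2 i (m + int r2) = b2 i m \<and> norm (b2 i m) \<le> R2"
  define L where "L = H * r2"
  define J where "J = {A<..A + int M}"
  define F where "F h = (\<Sum>k\<in>{k::int. real_of_int \<bar>k\<bar> \<le> real r1 / 2}.
    norm (\<Sum>i=1..I. B_hat r1 r2 H (b1 i) h k) * min_weight M r1 k)" for h
  define Q where "Q = {h::int. 0 < \<bar>h\<bar> \<and> real_of_int \<bar>h\<bar> \<le> real M / (real H * real r2)}"
  define P where "P h = norm (\<Sum>n\<in>{n\<in>J. n + h * int L \<in> J}. \<Sum>i=1..I. b1 i (n + h * int L) * cnj (b1 i n))" for h
  \<comment> \<open>Total bound for the correlations: the diagonal \<open>h = 0\<close> plus the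
    Fourier bounds over the admissible \<open>h\<close>.\<close>
  define G where "G = real M * (real I * R1\<^sup>2) + (\<Sum>h\<in>Q. F h)"
  have L: "L \<ge> 1" using H r2 by (simp add: L_def)
  have finQ: "finite Q"
    by (rule finite_subset[OF _ finite_int_abs_le[of "real M / (real H * real r2)"]]) (auto simp: Q_def)
  have F_nonneg: "F h \<ge> 0" for h
    by (auto simp: F_def min_weight_nonneg intro!: sum_nonneg)
  have bd1: "\<And>i m. i \<in> {1..I} \<Longrightarrow> norm (b1 i m) \<le> R1" and bd2: "\<And>i m. i \<in> {1..I} \<Longrightarrow> norm (b2 i m) \<le> R2"
    and per1: "\<And>i m. i \<in> {1..I} \<Longrightarrow> b1 i (m + int r1) = b1 i m"
    using bs by blast+
  have per2: "b2 i (m + int L) = b2 i m" if "i \<in> {1..I}" for i m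
    using periodic_int_mult[of "b2 i" "int r2" m "int H"] bs that by (simp add: L_def)
  have sum_b: "(\<Sum>m\<in>J. b m) = (\<Sum>m\<in>J. \<Sum>i=1..I. b1 i m * b2 i m)" using b by simp
  have main: "(norm (\<Sum>m\<in>J. b m))\<^sup>2
      \<le> 4 * ((real M + real L) * real L * (R1 * R2)\<^sup>2 * (real I)\<^sup>2 + real L * R2\<^sup>2 * real I * (\<Sum>h\<in>Q. F h))"
  proof (cases "M < L")
    case True
    have "norm (\<Sum>m\<in>J. b m) \<le> real M * (real I * (R1 * R2))"
      using norm_sum_products_le[of "{1..I}" b1 R1 b2 R2 J, OF bd1 bd2] unfolding sum_b by (simp add: J_def)
    then have "(norm (\<Sum>m\<in>J. b m))\<^sup>2 \<le> (real M * (real I * (R1 * R2)))\<^sup>2"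
      by (intro power_mono) auto
    also have "\<dots> = real M * real M * ((R1 * R2)\<^sup>2 * (real I)\<^sup>2)"
      by (simp add: power2_eq_square mult_ac)
    \<comment> \<open>Since \<open>M < L\<close>, the square of \<open>M\<close> is at most
      \<open>(M + L) * L\<close>, so the first term of the claim suffices.\<close>
    also have "\<dots> \<le> (real M + real L) * real L * ((R1 * R2)\<^sup>2 * (real I)\<^sup>2)"
      using True by (intro mult_right_mono mult_mono) auto
    finally have le: "(norm (\<Sum>m\<in>J. b m))\<^sup>2 \<le> (real M + real L) * real L * (R1 * R2)\<^sup>2 * (real I)\<^sup>2"
      by (simp add: mult_ac)
    have nonneg: "0 \<le> real L * R2\<^sup>2 * real I * (\<Sum>h\<in>Q. F h)"
      using F_nonneg by (intro mult_nonneg_nonneg sum_nonneg) auto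
    have widen: "x \<le> 4 * (y + z)" if "0 \<le> x" "x \<le> y" "0 \<le> z" for x y z :: real
      using that unfolding distrib_left by linarith
    show ?thesis by (rule widen[OF _ le nonneg]) simp
  next
    case False
    \<comment> \<open>The largest \<open>K\<close> with \<open>K * L \<le> M\<close>: the window
      \<open>W\<close> is then at most twice as long as \<open>J\<close>, and every nonzero
      \<open>h\<close> with \<open>\<bar>h\<bar> < K\<close> belongs to \<open>Q\<close>.\<close>
    define K where "K = M div L"
    have K: "K \<ge> 1" using False L by (simp add: K_def div_greater_zero_iff Suc_leI)
    have KL: "K * L \<le> M" by (simp add: K_def)
    have "M < (K + 1) * L" using L dividend_less_div_times[of L M] by (simp add: K_def)
    also have "\<dots> \<le> (2 * K) * L" using K by (intro mult_right_mono) auto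
    finally have "real M \<le> real (2 * K * L)" by (simp only: of_nat_le_iff)
    \<comment> \<open>The source of the constant 4:
      \<open>M + K * L \<le> 2 * M \<le> 4 * K * L\<close>.\<close>
    then have MK: "real M + real K * real L \<le> 4 * real L * real K"
      using of_nat_mono[OF KL, where 'a = real] by (simp add: mult_ac)
    have P0: "P 0 \<le> real M * (real I * R1\<^sup>2)"
    proof -
      have "P 0 = norm (\<Sum>n\<in>J. \<Sum>i=1..I. b1 i n * cnj (b1 i n))" by (simp add: P_def)
      also have "\<dots> \<le> real (card J) * (real (card {1..I}) * (R1 * R1))"
        by (rule norm_sum_products_le) (auto intro: bd1)
      finally show ?thesis by (simp add: J_def power2_eq_square)
    qed
    have PF: "P h \<le> F h" for h
      unfolding P_def F_def J_def L_def by (rule norm_correlation_le[OF r1]) (rule per1)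
    have sub: "{- int K<..<int K} - {0} \<subseteq> Q"
    proof
      fix h assume h: "h \<in> {- int K<..<int K} - {0}"
      then have "real_of_int \<bar>h\<bar> \<le> real K" by auto
      also have "real K \<le> real M / real L" using KL L
        by (simp add: pos_le_divide_eq flip: of_nat_mult)
      finally show "h \<in> Q" using h by (auto simp: Q_def L_def)
    qed
    have split0: "(\<Sum>h\<in>{- int K<..<int K}. P h) = P 0 + (\<Sum>h\<in>{- int K<..<int K} - {0}. P h)"
      using K by (intro sum.remove) auto
    have "(\<Sum>h\<in>{- int K<..<int K} - {0}. P h) \<le> (\<Sum>h\<in>{- int K<..<int K} - {0}. F h)"
      by (intro sum_mono PF)
    also have "\<dots> \<le> (\<Sum>h\<in>Q. F h)"
      using sub F_nonneg finQ by (intro sum_mono2) auto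
    finally have sumP: "(\<Sum>h\<in>{- int K<..<int K}. P h) \<le> G" using P0 split0 by (simp add: G_def)
    have "(real K)\<^sup>2 * (norm (\<Sum>m\<in>J. b m))\<^sup>2
        \<le> real I * (real M + real K * real L) * R2\<^sup>2 * (real K * (\<Sum>h\<in>{- int K<..<int K}. P h))"
      using van_der_corput_products[of "{1..I}" b2 L R2 K b1 A M, OF _ per2 bd2]
      by (simp add: P_def sum_b flip: J_def)
    \<comment> \<open>The window length and the count of shifts each contribute a factor
      \<open>K\<close>, which together cancel the square of \<open>K\<close> on the left.\<close>
    also have "\<dots> \<le> real I * (4 * real L * real K) * R2\<^sup>2 * (real K * G)"
      using MK sumP by (intro mult_mono) (auto simp: P_def intro!: mult_nonneg_nonneg sum_nonneg)
    also have "\<dots> = (real K)\<^sup>2 * (4 * real L * R2\<^sup>2 * real I * G)"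
      by (simp add: power2_eq_square mult_ac)
    finally have "(norm (\<Sum>m\<in>J. b m))\<^sup>2 \<le> 4 * real L * R2\<^sup>2 * real I * G"
      using K by simp
    \<comment> \<open>The diagonal part of \<open>G\<close> yields the term with
      \<open>M * L\<close>; enlarging \<open>M\<close> to \<open>M + L\<close> gives the stated
      form.\<close>
    also have "\<dots> = 4 * (real M * real L * (R1 * R2)\<^sup>2 * (real I)\<^sup>2 + real L * R2\<^sup>2 * real I * (\<Sum>h\<in>Q. F h))"
      by (simp add: G_def power2_eq_square algebra_simps)
    also have "\<dots> \<le> 4 * ((real M + real L) * real L * (R1 * R2)\<^sup>2 * (real I)\<^sup>2 + real L * R2\<^sup>2 * real I * (\<Sum>h\<in>Q. F h))"
      by (intro mult_left_mono add_right_mono mult_right_mono) auto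
    finally show ?thesis .
  qed
  show "(norm (\<Sum>m\<in>{A<..A + int M}. b m))\<^sup>2
        \<le> 4 * ((real M + real H * real r2) * real H * real r2 * (R1 * R2)\<^sup>2 * (real I)\<^sup>2
              + real H * real r2 * R2\<^sup>2 * real I *
                (\<Sum>h\<in>{h::int. 0 < \<bar>h\<bar> \<and> real_of_int \<bar>h\<bar> \<le> real M / (real H * real r2)}.
                  \<Sum>k\<in>{k::int. real_of_int \<bar>k\<bar> \<le> real r1 / 2}.
                    norm (\<Sum>i=1..I. B_hat r1 r2 H (b1 i) h k) * min_weight M r1 k))"
    using main by (simp add: J_def Q_def F_def L_def mult.assoc)
qed simp

end
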